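(* Let $S=\langle L,\leq,\top,\bot,\Box,\boxtimes\rangle$ be a consistent abstract provability structure and let $\triangle v$ be a one-variable APS term of even degree. Then $\triangle\top$ is not refutable in $S$.
   Context: An abstract provability structure (APS) is a tuple $S=\langle L,\leq,\top,\bot,\Box,\boxtimes\rangle$ where $L$ is a nonempty set, $\leq$ is a partial order on $L$, $\top,\bot\in L$, and $\Box,\boxtimes$ are unary operations on $L$ such that for all $x,y\in L$: (C1) if $x\leq y$ then $\Box x\leq\Box y$ and $\boxtimes y\leq\boxtimes x$; (C2) $\top\leq\boxtimes\bot$; (C3) if $x\leq\Box y$ and $x\leq\boxtimes y$ then $x\leq\boxtimes\top$; (C4) $\boxtimes x\leq\Box\boxtimes x$; (C5) $x\leq\top$. (It is not assumed that $\bot$ is the least element.) $S$ is consistent if $\top\not\leq\bot$. An element $x\in L$ is refutable in $S$ if $x\leq\bot$. A one-variable APS term $\triangle v$ is generated from the variable $v$ by finitely many applications of $\Box$ and $\boxtimes$; it induces a unary operation $x\mapsto\triangle x$ on $L$. The degree $d(\triangle)$ is the number of occurrences of $\boxtimes$ in $\triangle$ (degree $0$ counts as even). *)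

theory Defs
  imports Main
begin

record 'a aps_struct =
  carrier :: "'a set"
  le :: "'a \<Rightarrow> 'a \<Rightarrow> bool"  (infix "\<preceq>\<index>" 50)
  top_el :: 'a  ("\<top>\<index>")
  bot_el :: 'a  ("\<bottom>\<index>")
  box_op :: "'a \<Rightarrow> 'a"  ("\<box>\<index> _" [81] 80)
  boxtimes_op :: "'a \<Rightarrow> 'a"  ("\<boxtimes>\<index> _" [81] 80)

text \<open>
  The order is only constrained on the carrier. No axiom makes \<open>\<bottom>\<close> the least element.
\<close>

locale abstract_provability_structure =
  fixes S :: "'a aps_struct" (structure)
  assumes carrier_nonempty: "carrier S \<noteq> {}"
    and le_refl: "reflp_on (carrier S) (\<preceq>)"
    and le_antisym: "antisymp_on (carrier S) (\<preceq>)"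
    and le_trans: "transp_on (carrier S) (\<preceq>)"
    and top_closed: "\<top> \<in> carrier S"
    and bot_closed: "\<bottom> \<in> carrier S"
    and box_closed: "x \<in> carrier S \<Longrightarrow> \<box> x \<in> carrier S"
    and boxtimes_closed: "x \<in> carrier S \<Longrightarrow> \<boxtimes> x \<in> carrier S"
    and C1: "\<lbrakk>x \<in> carrier S; y \<in> carrier S; x \<preceq> y\<rbrakk> \<Longrightarrow> \<box> x \<preceq> \<box> y \<and> \<boxtimes> y \<preceq> \<boxtimes> x"
    and C2: "\<top> \<preceq> \<boxtimes> \<bottom>"
    and C3: "\<lbrakk>x \<in> carrier S; y \<in> carrier S; x \<preceq> \<box> y; x \<preceq> \<boxtimes> y\<rbrakk> \<Longrightarrow> x \<preceq> \<boxtimes> \<top>"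
    and C4: "x \<in> carrier S \<Longrightarrow> \<boxtimes> x \<preceq> \<box> (\<boxtimes> x)"
    and C5: "x \<in> carrier S \<Longrightarrow> x \<preceq> \<top>"

definition consistent :: "'a aps_struct \<Rightarrow> bool" where
  "consistent S \<longleftrightarrow> \<not> \<top>\<^bsub>S\<^esub> \<preceq>\<^bsub>S\<^esub> \<bottom>\<^bsub>S\<^esub>"

definition refutable :: "'a aps_struct \<Rightarrow> 'a \<Rightarrow> bool" where
  "refutable S x \<longleftrightarrow> x \<preceq>\<^bsub>S\<^esub> \<bottom>\<^bsub>S\<^esub>"

datatype aps_term = Var | Box aps_term | Boxtimes aps_term

primrec term_op :: "'a aps_struct \<Rightarrow> aps_term \<Rightarrow> 'a \<Rightarrow> 'a" where
  "term_op S Var x = x"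
| "term_op S (Box t) x = \<box>\<^bsub>S\<^esub> (term_op S t x)"
| "term_op S (Boxtimes t) x = \<boxtimes>\<^bsub>S\<^esub> (term_op S t x)"

primrec degree :: "aps_term \<Rightarrow> nat" where
  "degree Var = 0"
| "degree (Box t) = degree t"
| "degree (Boxtimes t) = Suc (degree t)"

end

theory Submission
  imports Defs
begin

text \<open>
  Always \<open>\<top> \<preceq> \<box> \<top>\<close> and \<open>\<box> \<bottom> \<preceq> \<boxtimes> \<top>\<close>, and
  every term of positive degree takes a value above \<open>\<boxtimes> \<top>\<close> at \<open>\<top>\<close>. So if such a value is
  refutable, then so is \<open>\<boxtimes> \<top>\<close>, whence \<open>\<box> \<bottom> \<preceq> \<bottom>\<close>. Thus \<open>\<box>\<close> preserves both being above
  \<open>\<top>\<close> and being below \<open>\<bottom>\<close>, while \<open>\<boxtimes>\<close> exchanges them, and even terms map \<open>\<top>\<close> above \<open>\<top>\<close>.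
\<close>

context abstract_provability_structure
begin

lemma trans_le:
  assumes "x \<preceq> y" "y \<preceq> z" "x \<in> carrier S" "y \<in> carrier S" "z \<in> carrier S"
  shows "x \<preceq> z"
  using transp_onD[OF le_trans] assms by blast

lemma term_op_closed: "x \<in> carrier S \<Longrightarrow> term_op S t x \<in> carrier S"
  by (induction t) (auto intro: box_closed boxtimes_closed)

text \<open>C2, C4 and then C5 under the monotone \<box> give the chain \<open>\<top> \<preceq>
  \<boxtimes> \<bottom> \<preceq> \<box> (\<boxtimes> \<bottom>) \<preceq> \<box>
  \<top>\<close>.\<close>

lemma top_le_box_top: "\<top> \<preceq> \<box> \<top>"
proof -
  have c: "\<boxtimes> \<bottom> \<in> carrier S" "\<box> (\<boxtimes> \<bottom>) \<in> carrier S" "\<box> \<top> \<in> carrier S"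
    by (simp_all add: top_closed bot_closed box_closed boxtimes_closed)
  have "\<box> (\<boxtimes> \<bottom>) \<preceq> \<box> \<top>"
    using C1 C5 c top_closed by blast
  then have "\<boxtimes> \<bottom> \<preceq> \<box> \<top>"
    using trans_le C4 bot_closed c by blast
  then show ?thesis
    using trans_le C2 top_closed c by blast
qed

lemma le_boxtimes_bot: "x \<in> carrier S \<Longrightarrow> x \<preceq> \<boxtimes> \<bottom>"
  using trans_le[OF C5 C2] top_closed bot_closed boxtimes_closed by blast

text \<open>In C3 with \<open>y = \<bottom>\<close>, the first premise is reflexivity and the second
  holds because \<open>\<boxtimes> \<bottom>\<close> is above every element.\<close>

lemma box_bot_le: "\<box> \<bottom> \<preceq> \<boxtimes> \<top>"
  using C3[of "\<box> \<bottom>" \<bottom>] le_boxtimes_bot[of "\<box> \<bottom>"] reflp_onD[OF le_refl]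
    bot_closed box_closed by blast

lemma top_le_term_op_degree_0: "degree t = 0 \<Longrightarrow> \<top> \<preceq> term_op S t \<top>"
proof (induction t)
  case Var
  then show ?case using C5 top_closed by simp
next
  case (Box t)
  then have "\<box> \<top> \<preceq> \<box> (term_op S t \<top>)"
    using C1 top_closed term_op_closed by simp
  then show ?case
    using trans_le[OF top_le_box_top] top_closed term_op_closed box_closed by simp
qed simp

text \<open>The outermost \<boxtimes> decides: its argument is below \<top>, so by antitonicity its
  value is above \<open>\<boxtimes> \<top>\<close>, and C4 carries this bound through the boxes
  outside it.\<close>

lemma boxtimes_top_le_term_op: "degree t > 0 \<Longrightarrow> \<boxtimes> \<top> \<preceq> term_op S t \<top>"
proof (induction t)
  case (Box t)
  then have "\<box> (\<boxtimes> \<top>) \<preceq> \<box> (term_op S t \<top>)"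
    using C1 top_closed term_op_closed boxtimes_closed by simp
  then show ?case
    using trans_le[OF C4] top_closed term_op_closed box_closed boxtimes_closed by simp
next
  case (Boxtimes t)
  then show ?case using C1 C5 top_closed term_op_closed by simp
qed simp

text \<open>The odd half serves the induction, since each \<boxtimes> swaps the two
  alternatives.\<close>

lemma term_op_top_parity:
  assumes "\<boxtimes> \<top> \<preceq> \<bottom>"
  shows "if even (degree t) then \<top> \<preceq> term_op S t \<top> else term_op S t \<top> \<preceq> \<bottom>"
proof (induction t)
  case Var
  then show ?case using C5 top_closed by simp
next
  case (Box t)
  let ?y = "term_op S t \<top>"
  have y: "?y \<in> carrier S" "\<box> ?y \<in> carrier S"
    using top_closed term_op_closed box_closed by simp_all
  have "\<box> \<bottom> \<preceq> \<bottom>"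
    using trans_le[OF box_bot_le assms] top_closed bot_closed box_closed boxtimes_closed by simp
  then have "\<box> ?y \<preceq> \<bottom>" if "?y \<preceq> \<bottom>"
    using that trans_le[of "\<box> ?y" "\<box> \<bottom>" \<bottom>] C1 y bot_closed box_closed by blast
  moreover have "\<top> \<preceq> \<box> ?y" if "\<top> \<preceq> ?y"
    using that trans_le[OF top_le_box_top] C1 y top_closed box_closed by blast
  ultimately show ?case using Box by (simp split: if_splits)
next
  case (Boxtimes t)
  let ?y = "term_op S t \<top>"
  have y: "?y \<in> carrier S" "\<boxtimes> ?y \<in> carrier S"
    using top_closed term_op_closed boxtimes_closed by simp_all
  \<comment> \<open>The hypothesis closes the chain \<open>\<boxtimes> ?y \<preceq> \<boxtimes>
    \<top> \<preceq> \<bottom>\<close>; in the opposite direction C2 takes its place.\<close>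
  have "\<boxtimes> ?y \<preceq> \<bottom>" if "\<top> \<preceq> ?y"
    using that trans_le[OF _ assms] C1 y top_closed bot_closed boxtimes_closed by blast
  moreover have "\<top> \<preceq> \<boxtimes> ?y" if "?y \<preceq> \<bottom>"
    using that trans_le[OF C2] C1 y top_closed bot_closed boxtimes_closed by blast
  ultimately show ?case using Boxtimes by (simp split: if_splits)
qed

end

theorem theorem6p6:
  fixes S :: "'a aps_struct" and t :: aps_term
  assumes "abstract_provability_structure S"
    and "consistent S"
    and "even (degree t)"
  shows "\<not> refutable S (term_op S t \<top>\<^bsub>S\<^esub>)"
proof
  interpret abstract_provability_structure S by fact
  assume "refutable S (term_op S t \<top>\<^bsub>S\<^esub>)"
  then have r: "term_op S t \<top>\<^bsub>S\<^esub> \<preceq>\<^bsub>S\<^esub> \<bottom>\<^bsub>S\<^esub>"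
    by (simp add: refutable_def)
  have c: "term_op S t \<top>\<^bsub>S\<^esub> \<in> carrier S"
    using term_op_closed top_closed by blast
  have "\<top>\<^bsub>S\<^esub> \<preceq>\<^bsub>S\<^esub> term_op S t \<top>\<^bsub>S\<^esub>"
  \<comment> \<open>In degree 0 the bound holds outright; in positive degree the refutability
    assumed for contradiction supplies the hypothesis of the parity lemma.\<close>
  proof (cases "degree t = 0")
    case True
    then show ?thesis by (rule top_le_term_op_degree_0)
  next
    case False
    then have "\<boxtimes>\<^bsub>S\<^esub> \<top>\<^bsub>S\<^esub> \<preceq>\<^bsub>S\<^esub> \<bottom>\<^bsub>S\<^esub>"
      using trans_le[OF boxtimes_top_le_term_op r] c top_closed bot_closed boxtimes_closed by blast
    then show ?thesis
      using term_op_top_parity[of t] assms(3) by simp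
  qed
  then have "\<top>\<^bsub>S\<^esub> \<preceq>\<^bsub>S\<^esub> \<bottom>\<^bsub>S\<^esub>"
    using trans_le r c top_closed bot_closed by blast
  then show False
    using assms(2) by (simp add: consistent_def)
qed

end
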